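(* Every word of length $25$ over the binary alphabet $\{a,b\}$ that contains neither $aaa$ nor $bb$ as a factor contains an abelian $5$-power. This bound is tight: the word $aababaababaababaababaaba$ of length $24$ contains neither $aaa$ nor $bb$ as a factor and does not contain an abelian $5$-power.
   Context: A factor of a word is a contiguous subword. A word contains an abelian $k$-power if it has a factor of the form $v_1v_2\cdots v_k$ where $v_1,\dots,v_k$ are non-empty words that are permutations (anagrams) of one another. *)

theory Defs
  imports "HOL-Library.Sublist" "HOL-Combinatorics.List_Permutation"
begin

datatype letter = A | B

(* "Factor" is the library's sublist (contiguous).  Only k \<ge> 1 is meaningful:
   for k = 0 the predicate holds for every word, witnessed by vs = []. *)
definition contains_abelian_power :: "nat \<Rightarrow> 'a list \<Rightarrow> bool" where
  "contains_abelian_power k w \<longleftrightarrow>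
     (\<exists>vs. length vs = k \<and> (\<forall>v\<in>set vs. v \<noteq> []) \<and>
        (\<forall>u\<in>set vs. \<forall>v\<in>set vs. u <~~> v) \<and> sublist (concat vs) w)"

end

theory Submission
  imports Defs
begin

text \<open>
  Both halves are finite checks carried out by the simplifier. Over two letters, words of equal
  length are anagrams iff they contain equally many \<^const>\<open>A\<close>s, so it is decidable whether a word
  starts with an abelian power. For the upper bound, words are extended letter by letter to the
  left, and a branch is cut as soon as the current word starts with \<open>AAA\<close>, \<open>BB\<close> or an abelian
  fifth power; the search tree has fewer than a thousand nodes and dies out at depth 25.
\<close>

text \<open>The sublist of \<^const>\<open>A\<close>s is a unary count.\<close>

fun blocks_match :: "nat \<Rightarrow> nat \<Rightarrow> letter list \<Rightarrow> letter list \<Rightarrow> bool" where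
  "blocks_match 0 m c w \<longleftrightarrow> True"
| "blocks_match (Suc k) m c w \<longleftrightarrow>
     length (take m w) = m \<and> filter ((=) A) (take m w) = c \<and> blocks_match k m c (drop m w)"

text \<open>\<open>k\<close> blocks of length \<open>m\<close> fit only if
  \<open>k * m \<le> length w\<close>, which bounds the search; starting at 1 rules out empty
  blocks. The first block supplies the count that the others must match.\<close>

definition starts_with_power :: "nat \<Rightarrow> letter list \<Rightarrow> bool" where
  "starts_with_power k w \<longleftrightarrow>
     list_ex (\<lambda>m. blocks_match k m (filter ((=) A) (take m w)) w) [1..<Suc (length w div k)]"

text \<open>Prefixes suffice: words grow on the left, so a new forbidden factor must begin at the
  newest letter.\<close>

definition cut :: "nat \<Rightarrow> letter list \<Rightarrow> bool" where
  "cut k w \<longleftrightarrow> prefix [A, A, A] w \<or> prefix [B, B] w \<or> starts_with_power k w"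

fun search_dies :: "nat \<Rightarrow> nat \<Rightarrow> letter list \<Rightarrow> bool" where
  "search_dies k 0 w \<longleftrightarrow> cut k w"
| "search_dies k (Suc n) w \<longleftrightarrow>
     cut k w \<or> (search_dies k n (A # w) \<and> search_dies k n (B # w))"

text \<open>A multiset over two letters is determined by its two counts, and the length is their
  sum.\<close>

lemma perm_letters_iff:
  fixes u v :: "letter list"
  shows "u <~~> v \<longleftrightarrow> length u = length v \<and> filter ((=) A) u = filter ((=) A) v"
proof -
  have *: "length w = count (mset w) A + count (mset w) B
      \<and> filter ((=) A) w = replicate (count (mset w) A) A" for w :: "letter list"
  proof (induction w)
    case (Cons x w)
    then show ?case by (cases x) simp_all
  qed simp
  have "mset u = mset v \<longleftrightarrow> count (mset u) A = count (mset v) A \<and> count (mset u) B = count (mset v) B"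
    unfolding multiset_eq_iff by (auto intro: letter.induct)
  also have "\<dots> \<longleftrightarrow> length u = length v \<and> filter ((=) A) u = filter ((=) A) v"
    using *[of u] *[of v] by auto
  finally show ?thesis .
qed

lemma blocks_match_iff:
  "blocks_match k m c w \<longleftrightarrow>
     (\<exists>vs. length vs = k \<and> (\<forall>v\<in>set vs. length v = m \<and> filter ((=) A) v = c) \<and>
        prefix (concat vs) w)"
proof (induction k arbitrary: w)
  case (Suc k)
  show ?case
  proof
    assume "blocks_match (Suc k) m c w"
    then have w: "length (take m w) = m" "filter ((=) A) (take m w) = c"
      and "blocks_match k m c (drop m w)" by auto
    with Suc obtain vs where vs: "length vs = k"
      "\<forall>v\<in>set vs. length v = m \<and> filter ((=) A) v = c" "prefix (concat vs) (drop m w)" by auto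
    \<comment> \<open>The split of \<open>w\<close> has to stay visible for the common first block
      to cancel; full simplification would fuse it back to \<open>w\<close>.\<close>
    have "prefix (concat (take m w # vs)) (take m w @ drop m w)"
      using vs(3) by (simp only: concat.simps same_prefix_prefix)
    then show "\<exists>vs. length vs = Suc k \<and> (\<forall>v\<in>set vs. length v = m \<and> filter ((=) A) v = c) \<and>
        prefix (concat vs) w"
      using w vs(1,2) by (intro exI[of _ "take m w # vs"]) auto
  next
    assume "\<exists>vs. length vs = Suc k \<and> (\<forall>v\<in>set vs. length v = m \<and> filter ((=) A) v = c) \<and>
        prefix (concat vs) w"
    then obtain v vs z where "length vs = k" "length v = m" "filter ((=) A) v = c"
      "\<forall>v\<in>set vs. length v = m \<and> filter ((=) A) v = c" "w = v @ concat vs @ z"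
      by (auto simp: length_Suc_conv prefix_def)
    with Suc show "blocks_match (Suc k) m c w" by auto
  qed
qed auto

lemma starts_with_power_iff:
  assumes "k > 0"
  shows "starts_with_power k w \<longleftrightarrow>
     (\<exists>vs. length vs = k \<and> (\<forall>v\<in>set vs. v \<noteq> []) \<and> (\<forall>u\<in>set vs. \<forall>v\<in>set vs. u <~~> v) \<and>
        prefix (concat vs) w)"
proof
  assume "starts_with_power k w"
  then obtain m c where "m > 0" and "blocks_match k m c w"
    unfolding starts_with_power_def list_ex_iff
    by (metis One_nat_def Suc_le_lessD atLeastLessThan_iff set_upt)
  moreover from this(2) obtain vs where "length vs = k" "prefix (concat vs) w"
    and v: "\<And>v. v \<in> set vs \<Longrightarrow> length v = m \<and> filter ((=) A) v = c"
    unfolding blocks_match_iff by blast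
  moreover have "v \<noteq> []" if "v \<in> set vs" for v
    using v[OF that] \<open>m > 0\<close> by auto
  moreover have "u <~~> v" if "u \<in> set vs" "v \<in> set vs" for u v
    using v[OF that(1)] v[OF that(2)] unfolding perm_letters_iff by simp
  ultimately show "\<exists>vs. length vs = k \<and> (\<forall>v\<in>set vs. v \<noteq> []) \<and>
      (\<forall>u\<in>set vs. \<forall>v\<in>set vs. u <~~> v) \<and> prefix (concat vs) w"
    by blast
next
  assume "\<exists>vs. length vs = k \<and> (\<forall>v\<in>set vs. v \<noteq> []) \<and>
      (\<forall>u\<in>set vs. \<forall>v\<in>set vs. u <~~> v) \<and> prefix (concat vs) w"
  then obtain vs where vs: "length vs = k" "\<forall>v\<in>set vs. v \<noteq> []"
    "\<forall>u\<in>set vs. \<forall>v\<in>set vs. u <~~> v" "prefix (concat vs) w" by blast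
  \<comment> \<open>All blocks are anagrams of the first one, so its length and its
    \<open>A\<close>s serve as the common data.\<close>
  define m where "m = length (hd vs)"
  from vs(1) assms have hd: "hd vs \<in> set vs" and "vs \<noteq> []" by auto
  from vs(3) hd have v: "length v = m \<and> filter ((=) A) v = filter ((=) A) (hd vs)"
    if "v \<in> set vs" for v using that unfolding perm_letters_iff m_def by blast
  \<comment> \<open>Comparing total lengths places \<open>m\<close> in the searched range.\<close>
  have "length (concat vs) = (\<Sum>v\<leftarrow>vs. m)"
    unfolding length_concat by (intro arg_cong[of _ _ sum_list] map_cong) (auto simp: v)
  also have "\<dots> = k * m"
    using vs(1) by (simp add: sum_list_triv)
  finally have "m \<le> length w div k"
    using prefix_length_le[OF vs(4)] assms
    by (simp add: less_eq_div_iff_mult_less_eq mult.commute)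
  moreover have "m > 0"
    using hd vs(2) by (simp add: m_def)
  ultimately have "m \<in> set [1..<Suc (length w div k)]" by auto
  moreover have "take m w = hd vs"
    using vs(4) \<open>vs \<noteq> []\<close> by (cases vs) (auto simp: m_def prefix_def)
  then have "blocks_match k m (filter ((=) A) (take m w)) w"
    unfolding blocks_match_iff using vs v by auto
  ultimately show "starts_with_power k w"
    unfolding starts_with_power_def list_ex_iff by blast
qed

text \<open>A factor is a prefix of a suffix.\<close>

lemma contains_abelian_power_iff:
  assumes "k > 0"
  shows "contains_abelian_power k w \<longleftrightarrow> list_ex (starts_with_power k) (suffixes w)"
  unfolding contains_abelian_power_def list_ex_iff starts_with_power_iff[OF assms]
    sublist_altdef' Bex_def in_set_suffixes by blast

text \<open>This makes pruning safe: whatever is found at the front of \<open>w\<close> remains a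
  factor of every extension to the left.\<close>

lemma cut_suffix:
  assumes "k > 0" "cut k w" "suffix w v"
  shows "sublist [A, A, A] v \<or> sublist [B, B] v \<or> contains_abelian_power k v"
proof -
  have "sublist u v" if "prefix u w" for u
    using that assms(3) sublist_altdef' by blast
  moreover have "contains_abelian_power k v" if "starts_with_power k w"
    unfolding contains_abelian_power_iff[OF assms(1)] list_ex_iff
    using that assms(3) by (intro bexI) simp_all
  ultimately show ?thesis
    using assms(2) unfolding cut_def by blast
qed

text \<open>Here \<open>u\<close> is the part still to be prepended, last letter first; hence the
  induction on \<open>u\<close> from the right with \<open>w\<close> varying. At a cut,
  \<open>cut_suffix\<close> settles all further extensions at once.\<close>

lemma search_dies_sound:
  assumes "k > 0" "search_dies k (length u) w"
  shows "sublist [A, A, A] (u @ w) \<or> sublist [B, B] (u @ w) \<or> contains_abelian_power k (u @ w)"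
  using assms(2)
proof (induction u arbitrary: w rule: rev_induct)
  case (snoc x u)
  show ?case
  proof (cases "cut k w")
    case True
    then show ?thesis by (rule cut_suffix[OF assms(1)]) (rule suffixI[OF refl])
  next
    case False
    with snoc.prems have "search_dies k (length u) (x # w)" by (cases x) auto
    from snoc.IH[OF this] show ?thesis by simp
  qed
next
  case Nil
  then show ?case using cut_suffix[OF assms(1)] by simp
qed

theorem proposition4p2:
  shows "(\<forall>w :: letter list. length w = 25 \<longrightarrow> \<not> sublist [A, A, A] w \<longrightarrow> \<not> sublist [B, B] w
            \<longrightarrow> contains_abelian_power 5 w) \<and>
         (let w = [A, A, B, A, B, A, A, B, A, B, A, A, B, A, B, A, A, B, A, B, A, A, B, A]
          in length w = 24 \<and> \<not> sublist [A, A, A] w \<and> \<not> sublist [B, B] w \<and>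
             \<not> contains_abelian_power 5 w)"
proof -
  have "search_dies 5 25 []" by code_simp
  \<comment> \<open>The search starts at the empty suffix, so \<open>u\<close> is the whole
    word.\<close>
  then have "contains_abelian_power 5 w" if "length w = 25" "\<not> sublist [A, A, A] w"
    "\<not> sublist [B, B] w" for w
    using search_dies_sound[of 5 w "[]"] that by simp
  moreover have "\<not> list_ex (starts_with_power 5)
      (suffixes [A, A, B, A, B, A, A, B, A, B, A, A, B, A, B, A, A, B, A, B, A, A, B, A])"
    by code_simp
  then have "\<not> contains_abelian_power 5
      [A, A, B, A, B, A, A, B, A, B, A, A, B, A, B, A, A, B, A, B, A, A, B, A]"
    by (simp only: contains_abelian_power_iff zero_less_numeral not_False_eq_True)
  \<comment> \<open>\<open>sublist_Cons_right\<close> turns the two remaining factor conditions into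
    prefix tests at each position of the concrete word.\<close>
  ultimately show ?thesis by (simp add: Let_def sublist_Cons_right)
qed

end
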